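(* Let $n,p\in\mathbb N$, $m=(n+1)p$, $T^*>0$, $\delta=\frac1{n+1}$, $t_i=\frac im T^*$ for $i=0,\dots,m$, and $T_j=\frac{j}{n+1}T^*$ for $j=1,\dots,n+1$. Let $(\lambda_{ij})_{i=0,\dots,m,\;j=1,\dots,n}$ be positive real numbers and let $L(0,T_j)$, $j=0,\dots,n$, be positive real numbers. Let $(\Omega,\mathcal F,(\mathcal F_t)_{t\ge0},\mathbb P)$ be a stochastic basis satisfying the usual conditions, and write $\mathbb P_{n+1}:=\mathbb P$. Let $(X_{t_i})_{i=1,\dots,m}$ be real random variables, adapted in the sense that $X_{t_i}$ is $\mathcal F_{t_i}$-measurable, such that $$\mathbb E_{\mathbb P_{n+1}}\Big(\exp\Big(\sum_{i=1}^m\sum_{j=1}^n\lambda_{ij}X_{t_i}\Big)\Big)<\infty .$$ Then there exists a discrete forward LIBOR market model, consisting of processes $(L(t_i,T_j))_{i=0,\dots,pj}$, $j=1,\dots,n$, and equivalent probability measures $\mathbb P_j$, $j=2,\dots,n+1$ (with the given $\mathbb P_{n+1}$), such that for every $j=1,\dots,n$ $$L(t_i,T_j)=L(0,T_j)\exp\Big(\sum_{u=1}^i\lambda_{uj}\big(X_{t_u}+b^j_{t_u}\big)\Big),\qquad i=1,\dots,jp,$$ where $$b^j_{t_i}=-\frac1{\lambda_{ij}}\log\mathbb E_{\mathbb P_{j+1}}\big(\exp(\lambda_{ij}X_{t_i})\,\big|\,\mathcal F_{t_{i-1}}\big).$$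
   Context: A family of stochastic processes $\{L(t_i,T_j)\}_{i=0,\dots,pj,\;j=1,\dots,n}$ together with a family of equivalent probability measures $\{\mathbb P_j\}_{j=2,\dots,n+1}$ is called a discrete forward LIBOR market model if: (1) for each $j=1,\dots,n$, the process $(L(t_i,T_j))_{i=0,\dots,pj}$ is a $\mathbb P_{j+1}$-martingale with respect to $(\mathcal F_{t_i})_i$; (2) for each $j=2,\dots,n$, the density process of $\mathbb P_j$ with respect to $\mathbb P_{j+1}$ is $$\frac{d\mathbb P_j}{d\mathbb P_{j+1}}(t_i)=\frac{1+\delta L(t_i,T_j)}{1+\delta L(0,T_j)},\qquad i=0,\dots,pj,$$ where $\frac{d\mathbb P_j}{d\mathbb P_{j+1}}(t_i)$ denotes the Radon–Nikodym density of $\mathbb P_j$ with respect to $\mathbb P_{j+1}$ on $\mathcal F_{t_i}$. The process $L(\cdot,T_j)$ starts at the given value $L(0,T_j)$ at $t_0=0$.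
   Formalization: Added assumption: for i=1,…,pn, E_P(exp(Σ_{j: i≤pj} λ_{ij}X_{t_i}) | F_{t_{i-1}}) is a.s. finite. Without it some b^j can be −∞ even though the stated exponential moment is finite, and the claim fails; it is equivalent to all drifts b^j being finite. *)

theory Defs
  imports "HOL-Probability.Probability"
begin

(* The filtration is indexed by the reals t >= 0; the values of F at negative reals are irrelevant. *)
locale stochastic_basis = prob_space M + complete_measure M
  for M :: "'a measure" +
  fixes F :: "real \<Rightarrow> 'a measure"
  assumes subalgebra_F: "\<And>t. 0 \<le> t \<Longrightarrow> subalgebra M (F t)"
    and F_mono: "\<And>s t. 0 \<le> s \<Longrightarrow> s \<le> t \<Longrightarrow> sets (F s) \<subseteq> sets (F t)"
    and F_right_continuous: "\<And>t. 0 \<le> t \<Longrightarrow> sets (F t) = (\<Inter>s\<in>{t<..}. sets (F s))"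
    and null_sets_F: "null_sets M \<subseteq> sets (F 0)"

definition equivalent_measures :: "'a measure \<Rightarrow> 'a measure \<Rightarrow> bool" where
  "equivalent_measures M N \<longleftrightarrow>
     sets M = sets N \<and> absolutely_continuous M N \<and> absolutely_continuous N M"

definition discrete_martingale ::
  "'a measure \<Rightarrow> (nat \<Rightarrow> 'a measure) \<Rightarrow> nat \<Rightarrow> (nat \<Rightarrow> 'a \<Rightarrow> real) \<Rightarrow> bool" where
  "discrete_martingale Q G N Y \<longleftrightarrow>
     (\<forall>i\<le>N. Y i \<in> borel_measurable (G i) \<and> integrable Q (Y i)) \<and>
     (\<forall>i k. i \<le> k \<longrightarrow> k \<le> N \<longrightarrow> (AE \<omega> in Q. real_cond_exp Q (G i) (Y k) \<omega> = Y i \<omega>))"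

definition RN_density_on :: "'a measure \<Rightarrow> 'a measure \<Rightarrow> 'a measure \<Rightarrow> 'a \<Rightarrow> ennreal" where
  "RN_density_on Q G P = RN_deriv (restr_to_subalg Q G) (restr_to_subalg P G)"

(* Processes are indexed by grid points: L i j is the random variable L(t_i, T_j), and G i is
   the sigma-algebra at time t_i.  The date T_j is the grid point t_i with i = p * j.
   P j is only meaningful for j = 2, ..., n + 1. *)
definition discrete_forward_LIBOR_model ::
  "nat \<Rightarrow> nat \<Rightarrow> real \<Rightarrow> (nat \<Rightarrow> 'a measure) \<Rightarrow> (nat \<Rightarrow> real) \<Rightarrow>
   (nat \<Rightarrow> 'a measure) \<Rightarrow> (nat \<Rightarrow> nat \<Rightarrow> 'a \<Rightarrow> real) \<Rightarrow> bool" where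
  "discrete_forward_LIBOR_model n p \<delta> G L0 P L \<longleftrightarrow>
     (\<forall>j\<in>{2..n+1}. prob_space (P j)) \<and>
     (\<forall>j\<in>{2..n+1}. \<forall>k\<in>{2..n+1}. equivalent_measures (P j) (P k)) \<and>
     (\<forall>j\<in>{1..n}. \<forall>\<omega>\<in>space (P (j + 1)). L 0 j \<omega> = L0 j) \<and>
     (\<forall>j\<in>{1..n}. discrete_martingale (P (j + 1)) G (p * j) (\<lambda>i. L i j)) \<and>
     (\<forall>j\<in>{2..n}. \<forall>i\<le>p * j. AE \<omega> in restr_to_subalg (P (j + 1)) (G i).
        RN_density_on (P (j + 1)) (G i) (P j) \<omega> =
          ennreal ((1 + \<delta> * L i j \<omega>) / (1 + \<delta> * L0 j)))"

(* The library's real_cond_exp of a nonnegative function is the finite part of the generalized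
   [0, infinity]-valued conditional expectation, so integrability of the exponential is not needed,
   but where that conditional expectation is infinite real_cond_exp is 0 and drift is 0. *)
definition drift ::
  "'a measure \<Rightarrow> (nat \<Rightarrow> 'a measure) \<Rightarrow> (nat \<Rightarrow> real) \<Rightarrow> (nat \<Rightarrow> 'a \<Rightarrow> real) \<Rightarrow> nat \<Rightarrow> 'a \<Rightarrow> real" where
  "drift Q G l X i \<omega> =
     - (1 / l i) * ln (real_cond_exp Q (G (i - 1)) (\<lambda>\<omega>'. exp (l i * X i \<omega>')) \<omega>)"

(* Finiteness almost surely of the conditional expectations under the logarithms in the drifts.
   Changing measure from P (j + 1) to M multiplies exp (lam i j * X i) by the product over
   k = j + 1, ..., n of 1 + delta * L i k (up to a constant), in which exp (lam i k * X i) enters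
   L i k with a positive factor known at t_{i-1}.  Hence finiteness for all j with i <= p * j is
   equivalent to finiteness, under M, for the sum of those lam i j.  It does not follow from
   integrability of exp of the sum of lam i j * X i over all i and j, where later X i can offset
   earlier ones: if exp (lam 1 1 * X 1) is not integrable and F at time 0 is trivial, take
   X 2 = - (lam 1 1 / lam 2 1) * X 1 in the case n = p = 1. *)
definition drifts_well_defined ::
  "'a measure \<Rightarrow> (nat \<Rightarrow> 'a measure) \<Rightarrow> nat \<Rightarrow> nat \<Rightarrow> (nat \<Rightarrow> nat \<Rightarrow> real) \<Rightarrow>
   (nat \<Rightarrow> 'a \<Rightarrow> real) \<Rightarrow> bool" where
  "drifts_well_defined M G n p lam X \<longleftrightarrow>
     (\<forall>i\<in>{1..p * n}. AE \<omega> in M.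
        nn_cond_exp M (G (i - 1))
          (\<lambda>\<omega>'. ennreal (exp (\<Sum>j | j \<in> {1..n} \<and> i \<le> p * j. lam i j * X i \<omega>'))) \<omega> < \<infinity>)"

end

theory Submission
  imports Defs
begin

text \<open>
  The forward measures are found by backward induction on the tenor, starting from \<open>P (n + 1) = M\<close>.
  Once \<open>P (j + 1)\<close> is known, the requested formula defines the rate \<open>L(\<cdot>, T\<^sub>j)\<close>, since its drift
  only involves \<open>P (j + 1)\<close>.  The drift divides each factor \<open>exp (\<lambda> X)\<close> by its conditional
  expectation given the previous grid time, so the rate is a positive martingale starting at
  \<open>L0 j\<close>.  Hence \<open>(1 + \<delta> L) / (1 + \<delta> L0 j)\<close> is a positive martingale of mean one, and its
  value at \<open>T\<^sub>j\<close> is the density of the next measure \<open>P j\<close>.  On an earlier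
  sigma-algebra the density is the conditional expectation of this terminal value, that is, the
  value of the martingale at the earlier time, which is condition (2) of the model.

  The point that needs an argument is that the construction can be continued: dividing by a
  conditional expectation only gives a martingale where that expectation is finite, and the
  measure changes in each step.  The property that survives is that, under \<open>P (j + 1)\<close>,
  \<open>exp (s\<^sub>j X\<^sub>i)\<close> has an almost surely finite conditional expectation given time \<open>i - 1\<close>, where
  \<open>s\<^sub>j\<close> is the sum of \<open>\<lambda>\<^sub>i\<^sub>k\<close> over all \<open>k \<le> j\<close> with \<open>i \<le> p k\<close>.  For \<open>j = n\<close> this is the
  assumption on the drifts.  Passing to \<open>P j\<close> multiplies the integrand by the density at time \<open>i\<close>,
  which is at most a quantity known at time \<open>i - 1\<close> times \<open>1 + exp (\<lambda>\<^sub>i\<^sub>j X\<^sub>i)\<close>; this costs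
  exactly the summand \<open>\<lambda>\<^sub>i\<^sub>j\<close> by which \<open>s\<^sub>j\<close> exceeds \<open>s\<^sub>j\<^sub>-\<^sub>1\<close>
  (\<open>cond_exp_finite_Q'\<close>, \<open>admissible_R\<close>).

  Conditional expectations are computed throughout for \<open>[0, \<infinity>]\<close>-valued functions, because
  \<open>exp (\<lambda> X)\<close> may fail to be integrable even where its conditional expectation is finite.
\<close>

section \<open>Nonnegative conditional expectations\<close>

text \<open>The integral of \<open>f\<close> over the set where its conditional expectation vanishes is zero, so a
  positive \<open>f\<close> forces that set to be null.\<close>

lemma (in sigma_finite_subalgebra) nn_cond_exp_pos:
  assumes [measurable]: "f \<in> borel_measurable M" and pos: "AE x in M. 0 < f x"
  shows "AE x in M. 0 < nn_cond_exp M F f x"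
proof -
  define A where "A = {x \<in> space F. nn_cond_exp M F f x = 0}"
  have AF[measurable]: "A \<in> sets F" unfolding A_def by measurable
  have AM[measurable]: "A \<in> sets M" using AF subalg by (auto simp: subalgebra_def)
  have "(\<integral>\<^sup>+ x. indicator A x * f x \<partial>M) = (\<integral>\<^sup>+ x. indicator A x * nn_cond_exp M F f x \<partial>M)"
    by (rule nn_cond_exp_intg[symmetric]) auto
  also have "\<dots> = (\<integral>\<^sup>+ x. 0 \<partial>M)"
    by (rule nn_integral_cong) (auto simp: A_def indicator_def)
  finally have "(\<integral>\<^sup>+ x. indicator A x * f x \<partial>M) = 0" by simp
  then have "AE x in M. indicator A x * f x = 0"
    by (subst (asm) nn_integral_0_iff_AE) auto
  with pos AE_space show ?thesis
  proof eventually_elim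
    case (elim x)
    then have "x \<notin> A" by (auto simp: indicator_def)
    with \<open>x \<in> space M\<close> show ?case using subalg
      by (auto simp: A_def subalgebra_def zero_less_iff_neq_zero)
  qed
qed

text \<open>Bayes' formula.  Integrated over a set of \<open>F\<close>, both sides give the integral of \<open>f\<close> under the
  new measure: on the left, the \<open>F\<close>-measurable conditional expectation under the new measure lets
  \<open>Z\<close> be replaced by its own conditional expectation.\<close>

lemma (in sigma_finite_subalgebra) nn_cond_exp_density:
  assumes "sigma_finite_subalgebra (density M Z) F"
    and [measurable]: "Z \<in> borel_measurable M" "f \<in> borel_measurable M"
  shows "AE x in M. nn_cond_exp M F Z x * nn_cond_exp (density M Z) F f x
           = nn_cond_exp M F (\<lambda>x. Z x * f x) x"
proof (rule nn_cond_exp_charact)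
  interpret Z: sigma_finite_subalgebra "density M Z" F by fact
  let ?h = "nn_cond_exp (density M Z) F f"
  have h[measurable]: "?h \<in> borel_measurable M"
    by (rule measurable_from_subalg[OF subalg]) simp
  show "(\<lambda>x. nn_cond_exp M F Z x * ?h x) \<in> borel_measurable F" by measurable
  show "(\<lambda>x. Z x * f x) \<in> borel_measurable M" by measurable
  fix A assume AF[measurable]: "A \<in> sets F"
  have AM[measurable]: "A \<in> sets M" using AF subalg by (auto simp: subalgebra_def)
  have "(\<integral>\<^sup>+x\<in>A. (Z x * f x) \<partial>M) = (\<integral>\<^sup>+x. Z x * (indicator A x * f x) \<partial>M)"
    by (simp add: ac_simps)
  also have "\<dots> = (\<integral>\<^sup>+x. indicator A x * f x \<partial>density M Z)"
    by (rule nn_integral_density[symmetric]) auto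
  also have "\<dots> = (\<integral>\<^sup>+x. indicator A x * ?h x \<partial>density M Z)"
    by (rule Z.nn_cond_exp_intg[symmetric]) auto
  also have "\<dots> = (\<integral>\<^sup>+x. Z x * (indicator A x * ?h x) \<partial>M)"
    by (rule nn_integral_density) auto
  also have "\<dots> = (\<integral>\<^sup>+x. (indicator A x * ?h x) * Z x \<partial>M)"
    by (simp add: ac_simps)
  also have "\<dots> = (\<integral>\<^sup>+x. (indicator A x * ?h x) * nn_cond_exp M F Z x \<partial>M)"
    by (rule nn_cond_exp_intg[symmetric]) auto
  finally show "(\<integral>\<^sup>+x\<in>A. (Z x * f x) \<partial>M) = (\<integral>\<^sup>+x\<in>A. (nn_cond_exp M F Z x * ?h x) \<partial>M)"
    by (simp add: ac_simps)
qed

lemma (in sigma_finite_subalgebra) real_cond_exp_eq_nn_cond_exp: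
  assumes [measurable]: "f \<in> borel_measurable M" and nn: "\<And>x. 0 \<le> f x"
  shows "AE x in M. real_cond_exp M F f x = enn2real (nn_cond_exp M F (\<lambda>x. ennreal (f x)) x)"
proof -
  have "AE x in M. nn_cond_exp M F (\<lambda>x. ennreal (- f x)) x = nn_cond_exp M F (\<lambda>_. 0) x"
    by (rule nn_cond_exp_cong) (use nn in \<open>auto simp: ennreal_neg\<close>)
  moreover have "AE x in M. 0 = nn_cond_exp M F (\<lambda>_. 0::ennreal) x"
    by (rule nn_cond_exp_F_meas) simp
  ultimately show ?thesis
    by eventually_elim (simp add: real_cond_exp_def)
qed

text \<open>\<open>Z\<close> and its conditional expectation have the same integral over every set of \<open>F\<close>, so the
  latter is the density seen by \<open>F\<close>.\<close>

lemma (in sigma_finite_subalgebra) RN_density_on_density: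
  assumes [measurable]: "Z \<in> borel_measurable M" "g \<in> borel_measurable F"
    and eq: "AE x in M. nn_cond_exp M F Z x = g x"
  shows "AE x in restr_to_subalg M F. RN_density_on M F (density M Z) x = g x"
proof -
  have sub: "subalgebra (density M Z) F"
    using subalg by (simp add: subalgebra_def)
  have gM[measurable]: "g \<in> borel_measurable M"
    by (rule measurable_from_subalg[OF subalg]) simp
  have gR[measurable]: "g \<in> borel_measurable (restr_to_subalg M F)"
    by (rule measurable_in_subalg[OF subalg]) simp
  have "density (restr_to_subalg M F) g = restr_to_subalg (density M Z) F"
  proof (rule measure_eqI)
    show "sets (density (restr_to_subalg M F) g) = sets (restr_to_subalg (density M Z) F)"
      by (simp add: sets_restr_to_subalg[OF subalg] sets_restr_to_subalg[OF sub])
    fix A assume "A \<in> sets (density (restr_to_subalg M F) g)"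
    then have AF[measurable]: "A \<in> sets F" by (simp add: sets_restr_to_subalg[OF subalg])
    have AM[measurable]: "A \<in> sets M" using AF subalg by (auto simp: subalgebra_def)
    have AR[measurable]: "A \<in> sets (restr_to_subalg M F)"
      by (simp add: sets_restr_to_subalg[OF subalg])
    have "emeasure (density (restr_to_subalg M F) g) A
        = (\<integral>\<^sup>+x. g x * indicator A x \<partial>restr_to_subalg M F)"
      by (rule emeasure_density) auto
    also have "\<dots> = (\<integral>\<^sup>+x. g x * indicator A x \<partial>M)"
      by (rule nn_integral_subalgebra2[OF subalg]) simp
    also have "\<dots> = (\<integral>\<^sup>+x. indicator A x * nn_cond_exp M F Z x \<partial>M)"
      by (rule nn_integral_cong_AE) (use eq in eventually_elim, simp add: ac_simps)
    also have "\<dots> = (\<integral>\<^sup>+x. indicator A x * Z x \<partial>M)"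
      by (rule nn_cond_exp_intg) auto
    also have "\<dots> = emeasure (density M Z) A"
      by (subst emeasure_density) (auto simp: ac_simps)
    also have "\<dots> = emeasure (restr_to_subalg (density M Z) F) A"
      by (rule emeasure_restr_to_subalg[OF sub, symmetric]) simp
    finally show "emeasure (density (restr_to_subalg M F) g) A
        = emeasure (restr_to_subalg (density M Z) F) A" .
  qed
  from sigma_finite_measure.RN_deriv_unique[OF sigma_fin_subalg gR this]
  show ?thesis unfolding RN_density_on_def by eventually_elim simp
qed

section \<open>Equivalence of measures\<close>

lemma equivalent_measures_density_pos:
  assumes [measurable]: "Z \<in> borel_measurable M" and pos: "\<And>x. 0 < Z x"
  shows "equivalent_measures M (density M Z)"
  unfolding equivalent_measures_def absolutely_continuous_def
proof (intro conjI subsetI)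
  fix A assume "A \<in> null_sets (density M Z)"
  then have "A \<in> sets M" "AE x in M. x \<notin> A"
    using pos by (auto simp: null_sets_density_iff zero_less_iff_neq_zero)
  then show "A \<in> null_sets M" by (simp add: AE_iff_null_sets)
next
  fix A assume "A \<in> null_sets M"
  then show "A \<in> null_sets (density M Z)"
    using absolutely_continuousI_density[of Z M] by (auto simp: absolutely_continuous_def)
qed simp

lemma equivalent_measures_sym: "equivalent_measures M N \<Longrightarrow> equivalent_measures N M"
  by (auto simp: equivalent_measures_def)

lemma equivalent_measures_trans:
  "equivalent_measures M N \<Longrightarrow> equivalent_measures N K \<Longrightarrow> equivalent_measures M K"
  by (auto simp: equivalent_measures_def absolutely_continuous_def)

section \<open>Conditional exponential moments\<close>

lemma exp_mult_le_one_plus_exp_mult: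
  fixes r s x :: real
  assumes "0 \<le> r" "r \<le> s"
  shows "exp (r * x) \<le> 1 + exp (s * x)"
proof (cases "0 \<le> x")
  case True
  then have "exp (r * x) \<le> exp (s * x)" using assms by (simp add: mult_right_mono)
  then show ?thesis by (simp add: add_increasing)
next
  case False
  then have "exp (r * x) \<le> 1" using assms by (simp add: mult_nonneg_nonpos)
  then show ?thesis by (simp add: add_increasing2)
qed

text \<open>Finiteness for a sum of volatilities thus passes to each of its summands.\<close>

lemma (in sigma_finite_subalgebra) nn_cond_exp_exp_finite_mono:
  assumes [measurable]: "Y \<in> borel_measurable M" and rs: "0 \<le> r" "r \<le> s"
    and fin: "AE \<omega> in M. nn_cond_exp M F (\<lambda>\<omega>. ennreal (exp (s * Y \<omega>))) \<omega> < \<infinity>"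
  shows "AE \<omega> in M. nn_cond_exp M F (\<lambda>\<omega>. ennreal (exp (r * Y \<omega>))) \<omega> < \<infinity>"
proof -
  let ?g = "\<lambda>\<omega>. ennreal (exp (s * Y \<omega>))"
  have "AE \<omega> in M. nn_cond_exp M F (\<lambda>\<omega>. ennreal (exp (r * Y \<omega>))) \<omega>
      \<le> nn_cond_exp M F (\<lambda>\<omega>. 1 + ?g \<omega>) \<omega>"
  proof (rule nn_cond_exp_mono)
    have "ennreal (exp (r * Y \<omega>)) \<le> ennreal (1 + exp (s * Y \<omega>))" for \<omega>
      by (intro ennreal_leI exp_mult_le_one_plus_exp_mult rs)
    then show "AE \<omega> in M. ennreal (exp (r * Y \<omega>)) \<le> 1 + ?g \<omega>"
      by (simp add: ennreal_plus)
  qed measurable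
  moreover have "AE \<omega> in M. nn_cond_exp M F (\<lambda>_. 1) \<omega> + nn_cond_exp M F ?g \<omega>
      = nn_cond_exp M F (\<lambda>\<omega>. 1 + ?g \<omega>) \<omega>"
    by (rule nn_cond_exp_sum) measurable
  moreover have "AE \<omega> in M. 1 = nn_cond_exp M F (\<lambda>_. 1) \<omega>"
    by (rule nn_cond_exp_F_meas) measurable
  moreover note fin
  ultimately show ?thesis
  proof eventually_elim
    case (elim \<omega>)
    have "nn_cond_exp M F (\<lambda>\<omega>. ennreal (exp (r * Y \<omega>))) \<omega> \<le> 1 + nn_cond_exp M F ?g \<omega>"
      using elim by simp
    also have "\<dots> < \<infinity>" using elim(4) by simp
    finally show ?case .
  qed
qed

section \<open>A single forward rate and its change of measure\<close>

definition libor ::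
  "'a measure \<Rightarrow> (nat \<Rightarrow> 'a measure) \<Rightarrow> (nat \<Rightarrow> real) \<Rightarrow> (nat \<Rightarrow> 'a \<Rightarrow> real) \<Rightarrow> real \<Rightarrow> nat \<Rightarrow> 'a \<Rightarrow> real" where
  "libor Q G l X x0 i \<omega> = x0 * exp (\<Sum>u=1..i. l u * (X u \<omega> + drift Q G l X u \<omega>))"

text \<open>The density of one forward measure with respect to its successor, as a function of the
  current rate.\<close>

definition forward_density :: "real \<Rightarrow> real \<Rightarrow> real \<Rightarrow> real" where
  "forward_density \<delta> x0 x = (1 + \<delta> * x) / (1 + \<delta> * x0)"

text \<open>One step of the backward construction: \<open>Q\<close> plays the role of \<open>P (j + 1)\<close>, \<open>N = p j\<close> is the
  maturity of the rate on the grid, and \<open>l\<close> is the volatility column of this rate.\<close>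

locale forward_rate = prob_space Q for Q :: "'a measure" +
  fixes G :: "nat \<Rightarrow> 'a measure" and N :: nat and l :: "nat \<Rightarrow> real"
    and X :: "nat \<Rightarrow> 'a \<Rightarrow> real" and x0 \<delta> :: real
  assumes subalg: "\<And>i. i \<le> N \<Longrightarrow> subalgebra Q (G i)"
    and mono: "\<And>i k. i \<le> k \<Longrightarrow> k \<le> N \<Longrightarrow> sets (G i) \<subseteq> sets (G k)"
    and l_pos: "\<And>i. 1 \<le> i \<Longrightarrow> i \<le> N \<Longrightarrow> 0 < l i"
    and X_meas: "\<And>i. 1 \<le> i \<Longrightarrow> i \<le> N \<Longrightarrow> X i \<in> borel_measurable (G i)"
    and cond_exp_finite: "\<And>i. 1 \<le> i \<Longrightarrow> i \<le> N \<Longrightarrow>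
      AE \<omega> in Q. nn_cond_exp Q (G (i - 1)) (\<lambda>\<omega>. ennreal (exp (l i * X i \<omega>))) \<omega> < \<infinity>"
    and x0_pos: "0 < x0" and \<delta>_nonneg: "0 \<le> \<delta>"
begin

abbreviation "L \<equiv> libor Q G l X x0"
abbreviation "D i \<omega> \<equiv> forward_density \<delta> x0 (L i \<omega>)"
definition "Q' = density Q (\<lambda>\<omega>. ennreal (D N \<omega>))"

lemma sigma_finite_G: "i \<le> N \<Longrightarrow> sigma_finite_subalgebra Q (G i)"
  by (intro finite_measure_subalgebra_is_sigma_finite finite_measure_subalgebra.intro
      finite_measure_subalgebra_axioms.intro subalg finite_measure_axioms)

lemma subalg_G: "i \<le> k \<Longrightarrow> k \<le> N \<Longrightarrow> subalgebra (G k) (G i)"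
  using subalg[of i] subalg[of k] mono[of i k] by (auto simp: subalgebra_def)

lemma measurable_G_mono:
  "f \<in> measurable (G i) K \<Longrightarrow> i \<le> k \<Longrightarrow> k \<le> N \<Longrightarrow> f \<in> measurable (G k) K"
  using measurable_from_subalg[OF subalg_G] by blast

lemma measurable_G_Q: "f \<in> measurable (G i) K \<Longrightarrow> i \<le> N \<Longrightarrow> f \<in> measurable Q K"
  using measurable_from_subalg[OF subalg] by blast

lemma drift_measurable: "drift Q G l X i \<in> borel_measurable (G (i - 1))"
  unfolding drift_def[abs_def] by measurable

lemma L_pos: "0 < L i \<omega>"
  using x0_pos by (simp add: libor_def)

lemma L_0: "L 0 \<omega> = x0"
  by (simp add: libor_def)

lemma L_Suc: "L (Suc i) \<omega> =
    L i \<omega> * exp (l (Suc i) * drift Q G l X (Suc i) \<omega>) * exp (l (Suc i) * X (Suc i) \<omega>)"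
  by (simp add: libor_def exp_add[symmetric] algebra_simps)

lemma L_measurable: "i \<le> N \<Longrightarrow> L i \<in> borel_measurable (G i)"
proof (induction i)
  case 0
  show ?case by (simp add: L_0[abs_def])
next
  case (Suc i)
  have [measurable]: "L i \<in> borel_measurable (G (Suc i))"
    "drift Q G l X (Suc i) \<in> borel_measurable (G (Suc i))"
    "X (Suc i) \<in> borel_measurable (G (Suc i))"
    using Suc measurable_G_mono[of _ i borel "Suc i"] drift_measurable[of "Suc i"]
    by (auto intro!: X_meas)
  show ?case unfolding L_Suc[abs_def] by measurable
qed

text \<open>The factor by which the rate grows is \<open>exp (l X)\<close> divided by its own conditional
  expectation, which is a legitimate division because that expectation is almost surely positive
  and finite.  The remaining factor is known one step earlier.\<close>

lemma L_cond_exp_Suc: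
  assumes i: "i < N"
  shows "AE \<omega> in Q. nn_cond_exp Q (G i) (\<lambda>\<omega>. ennreal (L (Suc i) \<omega>)) \<omega> = ennreal (L i \<omega>)"
proof -
  interpret S: sigma_finite_subalgebra Q "G i" using i by (intro sigma_finite_G) simp
  let ?b = "\<lambda>\<omega>. L i \<omega> * exp (l (Suc i) * drift Q G l X (Suc i) \<omega>)"
  let ?e = "\<lambda>\<omega>. exp (l (Suc i) * X (Suc i) \<omega>)"
  let ?E = "nn_cond_exp Q (G i) (\<lambda>\<omega>. ennreal (?e \<omega>))"
  have [measurable]: "L i \<in> borel_measurable (G i)"
      "drift Q G l X (Suc i) \<in> borel_measurable (G i)"
    using L_measurable[of i] drift_measurable[of "Suc i"] i by auto
  have [measurable]: "X (Suc i) \<in> borel_measurable Q"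
    using i by (intro measurable_G_Q[OF X_meas]) auto
  have l: "0 < l (Suc i)" using i by (intro l_pos) auto
  have "AE \<omega> in Q. ennreal (?b \<omega>) * ?E \<omega>
      = nn_cond_exp Q (G i) (\<lambda>\<omega>. ennreal (?b \<omega>) * ennreal (?e \<omega>)) \<omega>"
    by (rule S.nn_cond_exp_prod) auto
  moreover have "AE \<omega> in Q. 0 < ?E \<omega>"
    by (rule S.nn_cond_exp_pos) auto
  moreover have "AE \<omega> in Q. ?E \<omega> < \<infinity>"
    using cond_exp_finite[of "Suc i"] i by simp
  moreover have "AE \<omega> in Q. real_cond_exp Q (G i) ?e \<omega> = enn2real (?E \<omega>)"
    by (rule S.real_cond_exp_eq_nn_cond_exp) auto
  ultimately show ?thesis
  proof eventually_elim
    case (elim \<omega>)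
    define r where "r = enn2real (?E \<omega>)"
    have E: "?E \<omega> = ennreal r" using elim(3) by (simp add: r_def)
    have r: "0 < r" using elim(2,3) by (simp add: r_def enn2real_positive_iff)
    have "l (Suc i) * drift Q G l X (Suc i) \<omega> = - ln r"
      using l elim(4) by (simp add: drift_def r_def)
    then have b: "?b \<omega> = L i \<omega> / r"
      using r by (simp add: exp_minus field_simps)
    have *: "(\<lambda>\<omega>. ennreal (L (Suc i) \<omega>)) = (\<lambda>\<omega>. ennreal (?b \<omega>) * ennreal (?e \<omega>))"
      using L_pos by (auto simp: L_Suc ennreal_mult less_imp_le)
    have "nn_cond_exp Q (G i) (\<lambda>\<omega>. ennreal (L (Suc i) \<omega>)) \<omega> = ennreal (?b \<omega>) * ?E \<omega>"
      unfolding * using elim(1) by simp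
    also have "\<dots> = ennreal (L i \<omega>)"
      unfolding b E using r L_pos[of i \<omega>] by (simp add: ennreal_mult[symmetric] less_imp_le)
    finally show ?case .
  qed
qed

lemma L_cond_exp:
  assumes "i \<le> k" "k \<le> N"
  shows "AE \<omega> in Q. nn_cond_exp Q (G i) (\<lambda>\<omega>. ennreal (L k \<omega>)) \<omega> = ennreal (L i \<omega>)"
  using assms
proof (induction k rule: dec_induct)
  case base
  interpret S: sigma_finite_subalgebra Q "G i" using base by (rule sigma_finite_G)
  have [measurable]: "L i \<in> borel_measurable (G i)" using base by (rule L_measurable)
  have "AE \<omega> in Q. ennreal (L i \<omega>) = nn_cond_exp Q (G i) (\<lambda>\<omega>. ennreal (L i \<omega>)) \<omega>"
    by (rule S.nn_cond_exp_F_meas) measurable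
  then show ?case by eventually_elim simp
next
  case (step k)
  then have k: "i \<le> k" "k < N" "k \<le> N" by auto
  interpret S: sigma_finite_subalgebra Q "G i" using k by (intro sigma_finite_G) simp
  have [measurable]: "L k \<in> borel_measurable Q" "L (Suc k) \<in> borel_measurable Q"
    using L_measurable[of k] L_measurable[of "Suc k"] k step.prems
    by (auto intro: measurable_G_Q)
  have "AE \<omega> in Q. nn_cond_exp Q (G i) (\<lambda>\<omega>. ennreal (L (Suc k) \<omega>)) \<omega>
      = nn_cond_exp Q (G i) (nn_cond_exp Q (G k) (\<lambda>\<omega>. ennreal (L (Suc k) \<omega>))) \<omega>"
    by (rule S.nn_cond_exp_nested_subalg) (use k in \<open>auto intro: subalg subalg_G\<close>)
  moreover have "AE \<omega> in Q. nn_cond_exp Q (G i) (nn_cond_exp Q (G k) (\<lambda>\<omega>. ennreal (L (Suc k) \<omega>))) \<omega>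
      = nn_cond_exp Q (G i) (\<lambda>\<omega>. ennreal (L k \<omega>)) \<omega>"
    by (rule S.nn_cond_exp_cong[OF L_cond_exp_Suc[OF k(2)]]) measurable
  moreover have "AE \<omega> in Q. nn_cond_exp Q (G i) (\<lambda>\<omega>. ennreal (L k \<omega>)) \<omega> = ennreal (L i \<omega>)"
    using step.IH k by simp
  ultimately show ?case by eventually_elim simp
qed

text \<open>All \<open>L i\<close> have the same expectation as the constant \<open>L 0\<close>.\<close>

lemma L_integrable:
  assumes "i \<le> N"
  shows "integrable Q (L i)"
proof (rule integrableI_nonneg)
  interpret S: sigma_finite_subalgebra Q "G 0" by (intro sigma_finite_G) simp
  show [measurable]: "L i \<in> borel_measurable Q"
    using assms by (intro measurable_G_Q[OF L_measurable])
  show "AE \<omega> in Q. 0 \<le> L i \<omega>" using L_pos by (simp add: less_imp_le)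
  have "(\<integral>\<^sup>+ \<omega>. ennreal (L i \<omega>) \<partial>Q) = (\<integral>\<^sup>+ \<omega>. 1 * ennreal (L i \<omega>) \<partial>Q)" by simp
  also have "\<dots> = (\<integral>\<^sup>+ \<omega>. 1 * nn_cond_exp Q (G 0) (\<lambda>\<omega>. ennreal (L i \<omega>)) \<omega> \<partial>Q)"
    by (rule S.nn_cond_exp_intg[symmetric]) auto
  also have "\<dots> = (\<integral>\<^sup>+ \<omega>. ennreal (L 0 \<omega>) \<partial>Q)"
    by (rule nn_integral_cong_AE) (use L_cond_exp[of 0 i] assms in \<open>auto elim!: eventually_mono\<close>)
  also have "\<dots> < \<infinity>" by (simp add: L_0 emeasure_space_1)
  finally show "(\<integral>\<^sup>+ \<omega>. ennreal (L i \<omega>) \<partial>Q) < \<infinity>" .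
qed

lemma L_martingale: "discrete_martingale Q G N L"
  unfolding discrete_martingale_def
proof (intro conjI allI impI)
  fix i k assume ik: "i \<le> k" "k \<le> N"
  interpret S: sigma_finite_subalgebra Q "G i" using ik by (intro sigma_finite_G) simp
  have "AE \<omega> in Q. real_cond_exp Q (G i) (L k) \<omega>
      = enn2real (nn_cond_exp Q (G i) (\<lambda>\<omega>. ennreal (L k \<omega>)) \<omega>)"
    using ik L_pos by (intro S.real_cond_exp_eq_nn_cond_exp measurable_G_Q[OF L_measurable])
      (auto simp: less_imp_le)
  with L_cond_exp[OF ik] show "AE \<omega> in Q. real_cond_exp Q (G i) (L k) \<omega> = L i \<omega>"
    by eventually_elim (simp add: L_pos less_imp_le)
qed (use L_measurable L_integrable in auto)

lemma D_pos: "0 < D i \<omega>"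
  using L_pos[of i \<omega>] x0_pos \<delta>_nonneg
  by (simp add: forward_density_def add_pos_nonneg)

lemma D_measurable: "i \<le> N \<Longrightarrow> D i \<in> borel_measurable (G i)"
  using L_measurable[of i] unfolding forward_density_def by measurable

text \<open>\<open>D\<close> inherits the martingale property because it is an affine function of \<open>L\<close> with nonnegative
  coefficients.\<close>

lemma D_cond_exp:
  assumes "i \<le> N"
  shows "AE \<omega> in Q. nn_cond_exp Q (G i) (\<lambda>\<omega>. ennreal (D N \<omega>)) \<omega> = ennreal (D i \<omega>)"
proof -
  interpret S: sigma_finite_subalgebra Q "G i" using assms by (intro sigma_finite_G)
  define c where "c = 1 / (1 + \<delta> * x0)"
  have c: "0 \<le> c" using x0_pos \<delta>_nonneg by (simp add: c_def)
  have D: "ennreal (D k \<omega>) = ennreal c + ennreal (c * \<delta>) * ennreal (L k \<omega>)" for k \<omega>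
    using c \<delta>_nonneg L_pos[of k \<omega>]
    by (simp add: forward_density_def c_def ennreal_mult[symmetric] ennreal_plus[symmetric]
        less_imp_le add_divide_distrib mult_ac del: ennreal_plus)
  have [measurable]: "L N \<in> borel_measurable Q"
    by (intro measurable_G_Q[OF L_measurable]) auto
  have "AE \<omega> in Q. nn_cond_exp Q (G i) (\<lambda>_. ennreal c) \<omega>
        + nn_cond_exp Q (G i) (\<lambda>\<omega>. ennreal (c * \<delta>) * ennreal (L N \<omega>)) \<omega>
      = nn_cond_exp Q (G i) (\<lambda>\<omega>. ennreal c + ennreal (c * \<delta>) * ennreal (L N \<omega>)) \<omega>"
    by (rule S.nn_cond_exp_sum) auto
  moreover have "AE \<omega> in Q. ennreal (c * \<delta>) * nn_cond_exp Q (G i) (\<lambda>\<omega>. ennreal (L N \<omega>)) \<omega>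
      = nn_cond_exp Q (G i) (\<lambda>\<omega>. ennreal (c * \<delta>) * ennreal (L N \<omega>)) \<omega>"
    by (rule S.nn_cond_exp_prod) auto
  moreover have "AE \<omega> in Q. ennreal c = nn_cond_exp Q (G i) (\<lambda>_. ennreal c) \<omega>"
    by (rule S.nn_cond_exp_F_meas) auto
  moreover note L_cond_exp[OF assms order_refl]
  ultimately show ?thesis
    unfolding D by eventually_elim simp
qed

lemma D_measurable_Q [measurable]: "D N \<in> borel_measurable Q"
  by (rule measurable_G_Q[OF D_measurable]) auto

lemma sets_Q' [simp]: "sets Q' = sets Q" and space_Q' [simp]: "space Q' = space Q"
  by (simp_all add: Q'_def)

lemma prob_space_Q': "prob_space Q'"
proof
  interpret S: sigma_finite_subalgebra Q "G 0" by (intro sigma_finite_G) simp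
  have "emeasure Q' (space Q') = (\<integral>\<^sup>+ \<omega>. 1 * ennreal (D N \<omega>) \<partial>Q)"
    by (simp add: Q'_def emeasure_density cong: nn_integral_cong_simp)
  also have "\<dots> = (\<integral>\<^sup>+ \<omega>. 1 * nn_cond_exp Q (G 0) (\<lambda>\<omega>. ennreal (D N \<omega>)) \<omega> \<partial>Q)"
    by (rule S.nn_cond_exp_intg[symmetric]) auto
  also have "\<dots> = (\<integral>\<^sup>+ \<omega>. ennreal (D 0 \<omega>) \<partial>Q)"
    by (rule nn_integral_cong_AE) (use D_cond_exp[of 0] in \<open>auto elim!: eventually_mono\<close>)
  also have "\<dots> = 1"
    using x0_pos \<delta>_nonneg
    by (simp add: L_0 forward_density_def emeasure_space_1 add_pos_nonneg less_imp_neq[symmetric])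
  finally show "emeasure Q' (space Q') = 1" .
qed

lemma equivalent_Q': "equivalent_measures Q Q'"
  unfolding Q'_def by (rule equivalent_measures_density_pos) (auto simp: D_pos)

lemma AE_Q': "(AE \<omega> in Q. P \<omega>) \<Longrightarrow> AE \<omega> in Q'. P \<omega>"
  unfolding Q'_def by (simp add: AE_density eventually_mono)

lemma RN_density_Q':
  assumes "i \<le> N"
  shows "AE \<omega> in restr_to_subalg Q (G i). RN_density_on Q (G i) Q' \<omega> = ennreal (D i \<omega>)"
proof -
  interpret S: sigma_finite_subalgebra Q "G i" using assms by (rule sigma_finite_G)
  show ?thesis unfolding Q'_def
    using D_measurable[OF assms] D_cond_exp[OF assms]
    by (intro S.RN_density_on_density) auto
qed

text \<open>The step that keeps the construction going.  By Bayes' formula the conditional expectation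
  under \<open>Q'\<close> is, up to the positive factor \<open>D (i - 1)\<close>, that of \<open>D i * exp (s X)\<close> under \<open>Q\<close>.
  Since \<open>D i\<close> grows at most like \<open>exp (l X)\<close> with a coefficient known at time \<open>i - 1\<close>, the
  exponent \<open>s + l i\<close> under \<open>Q\<close> controls the exponent \<open>s\<close> under \<open>Q'\<close>.\<close>

lemma cond_exp_finite_Q':
  assumes i: "1 \<le> i" "i \<le> N" and s: "0 \<le> s"
    and fin: "AE \<omega> in Q. nn_cond_exp Q (G (i - 1)) (\<lambda>\<omega>. ennreal (exp ((s + l i) * X i \<omega>))) \<omega> < \<infinity>"
  shows "AE \<omega> in Q'. nn_cond_exp Q' (G (i - 1)) (\<lambda>\<omega>. ennreal (exp (s * X i \<omega>))) \<omega> < \<infinity>"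
proof -
  let ?H = "G (i - 1)"
  let ?f = "\<lambda>\<omega>. ennreal (exp (s * X i \<omega>))"
  let ?g = "\<lambda>\<omega>. ennreal (exp ((s + l i) * X i \<omega>))"
  let ?Z = "\<lambda>\<omega>. ennreal (D N \<omega>)"
  have i1: "i - 1 \<le> N" using i by simp
  interpret S: sigma_finite_subalgebra Q ?H using i1 by (rule sigma_finite_G)
  interpret I: sigma_finite_subalgebra Q "G i" using i by (intro sigma_finite_G)
  interpret Q': prob_space Q' by (rule prob_space_Q')
  have S': "sigma_finite_subalgebra (density Q ?Z) ?H"
    using S.subalg Q'.finite_measure_axioms unfolding Q'_def[symmetric]
    by (intro finite_measure_subalgebra_is_sigma_finite finite_measure_subalgebra.intro
      finite_measure_subalgebra_axioms.intro) (simp_all add: subalgebra_def)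
  have XG[measurable]: "X i \<in> borel_measurable (G i)" using i by (rule X_meas)
  have [measurable]: "X i \<in> borel_measurable Q" using XG i(2) by (rule measurable_G_Q)
  have DG[measurable]: "D i \<in> borel_measurable (G i)" using i(2) by (rule D_measurable)
  have [measurable]: "D i \<in> borel_measurable Q" using DG i(2) by (rule measurable_G_Q)
  \<comment> \<open>The part of \<open>L i\<close> that is known at time \<open>i - 1\<close>.\<close>
  define a where "a \<omega> = L (i - 1) \<omega> * exp (l i * drift Q G l X i \<omega>)" for \<omega>
  have [measurable]: "a \<in> borel_measurable ?H"
    using L_measurable[OF i1] drift_measurable[of i] unfolding a_def[abs_def] by measurable
  have [measurable]: "a \<in> borel_measurable Q"
    by (rule measurable_G_Q[of a "i - 1"]) (measurable, rule i1)
  have a: "0 \<le> a \<omega>" for \<omega> using L_pos[of "i - 1" \<omega>] by (simp add: a_def less_imp_le)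
  have D_le: "D i \<omega> \<le> (1 + \<delta> * a \<omega>) * (1 + exp (l i * X i \<omega>))" for \<omega>
  proof -
    have Li: "L i \<omega> = a \<omega> * exp (l i * X i \<omega>)"
      using i L_Suc[of "i - 1" \<omega>] by (simp add: a_def)
    have "D i \<omega> \<le> (1 + \<delta> * L i \<omega>) / 1"
      unfolding forward_density_def
      using x0_pos \<delta>_nonneg L_pos[of i \<omega>]
      by (intro divide_left_mono) (auto simp: add_pos_nonneg)
    also have "\<dots> \<le> (1 + \<delta> * a \<omega>) * (1 + exp (l i * X i \<omega>))"
      using a[of \<omega>] \<delta>_nonneg by (simp add: Li algebra_simps)
    finally show ?thesis .
  qed
  have f_le: "(1 + exp (l i * X i \<omega>)) * exp (s * X i \<omega>) \<le> 2 * (1 + exp ((s + l i) * X i \<omega>))" for \<omega>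
    using exp_mult_le_one_plus_exp_mult[OF s, of "s + l i" "X i \<omega>"] l_pos[OF i]
    by (simp add: algebra_simps exp_add)
  have "AE \<omega> in Q. nn_cond_exp Q ?H ?Z \<omega> * nn_cond_exp (density Q ?Z) ?H ?f \<omega>
      = nn_cond_exp Q ?H (\<lambda>\<omega>. ?Z \<omega> * ?f \<omega>) \<omega>"
    by (rule S.nn_cond_exp_density[OF S']) measurable
  moreover have "AE \<omega> in Q. nn_cond_exp Q ?H (\<lambda>\<omega>. ?Z \<omega> * ?f \<omega>) \<omega>
      = nn_cond_exp Q ?H (nn_cond_exp Q (G i) (\<lambda>\<omega>. ?Z \<omega> * ?f \<omega>)) \<omega>"
    using i by (intro S.nn_cond_exp_nested_subalg subalg subalg_G) auto
  moreover have "AE \<omega> in Q. nn_cond_exp Q ?H (nn_cond_exp Q (G i) (\<lambda>\<omega>. ?Z \<omega> * ?f \<omega>)) \<omega>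
      \<le> nn_cond_exp Q ?H (\<lambda>\<omega>. ennreal (2 * (1 + \<delta> * a \<omega>)) * (1 + ?g \<omega>)) \<omega>"
  proof (rule S.nn_cond_exp_mono)
    have "AE \<omega> in Q. ?f \<omega> * nn_cond_exp Q (G i) ?Z \<omega> = nn_cond_exp Q (G i) (\<lambda>\<omega>. ?f \<omega> * ?Z \<omega>) \<omega>"
      by (rule I.nn_cond_exp_prod) measurable
    with D_cond_exp[OF i(2)]
    show "AE \<omega> in Q. nn_cond_exp Q (G i) (\<lambda>\<omega>. ?Z \<omega> * ?f \<omega>) \<omega>
        \<le> ennreal (2 * (1 + \<delta> * a \<omega>)) * (1 + ?g \<omega>)"
    proof eventually_elim
      case (elim \<omega>)
      have a1: "0 \<le> 1 + \<delta> * a \<omega>" using a[of \<omega>] \<delta>_nonneg by simp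
      have "D i \<omega> * exp (s * X i \<omega>)
          \<le> (1 + \<delta> * a \<omega>) * (1 + exp (l i * X i \<omega>)) * exp (s * X i \<omega>)"
        using D_le by (rule mult_right_mono) simp
      also have "\<dots> \<le> (1 + \<delta> * a \<omega>) * (2 * (1 + exp ((s + l i) * X i \<omega>)))"
        unfolding mult.assoc using f_le a1 by (rule mult_left_mono)
      also have "\<dots> = 2 * (1 + \<delta> * a \<omega>) * (1 + exp ((s + l i) * X i \<omega>))"
        by (simp only: mult_ac)
      finally have le: "D i \<omega> * exp (s * X i \<omega>)
          \<le> 2 * (1 + \<delta> * a \<omega>) * (1 + exp ((s + l i) * X i \<omega>))" .
      have "nn_cond_exp Q (G i) (\<lambda>\<omega>. ?Z \<omega> * ?f \<omega>) \<omega> = ennreal (D i \<omega> * exp (s * X i \<omega>))"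
        using elim D_pos[of i \<omega>] by (simp add: mult.commute ennreal_mult less_imp_le)
      also have "\<dots> \<le> ennreal (2 * (1 + \<delta> * a \<omega>) * (1 + exp ((s + l i) * X i \<omega>)))"
        using le by (rule ennreal_leI)
      also have "\<dots> = ennreal (2 * (1 + \<delta> * a \<omega>)) * ennreal (1 + exp ((s + l i) * X i \<omega>))"
        using a1 by (intro ennreal_mult) (auto intro: add_nonneg_nonneg)
      also have "ennreal (1 + exp ((s + l i) * X i \<omega>)) = 1 + ?g \<omega>"
        by (simp add: ennreal_plus)
      finally show ?case .
    qed
  qed measurable
  moreover have "AE \<omega> in Q. ennreal (2 * (1 + \<delta> * a \<omega>)) * nn_cond_exp Q ?H (\<lambda>\<omega>. 1 + ?g \<omega>) \<omega>
      = nn_cond_exp Q ?H (\<lambda>\<omega>. ennreal (2 * (1 + \<delta> * a \<omega>)) * (1 + ?g \<omega>)) \<omega>"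
    by (rule S.nn_cond_exp_prod) measurable
  moreover have "AE \<omega> in Q. nn_cond_exp Q ?H (\<lambda>_. 1) \<omega> + nn_cond_exp Q ?H ?g \<omega>
      = nn_cond_exp Q ?H (\<lambda>\<omega>. 1 + ?g \<omega>) \<omega>"
    by (rule S.nn_cond_exp_sum) measurable
  moreover have "AE \<omega> in Q. 1 = nn_cond_exp Q ?H (\<lambda>_. 1) \<omega>"
    by (rule S.nn_cond_exp_F_meas) measurable
  moreover note fin D_cond_exp[OF i1]
  ultimately have "AE \<omega> in Q. nn_cond_exp (density Q ?Z) ?H ?f \<omega> < \<infinity>"
  proof eventually_elim
    case (elim \<omega>)
    have "ennreal (D (i - 1) \<omega>) * nn_cond_exp (density Q ?Z) ?H ?f \<omega>
        \<le> ennreal (2 * (1 + \<delta> * a \<omega>)) * (1 + nn_cond_exp Q ?H ?g \<omega>)"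
      using elim by simp
    also have "\<dots> < \<infinity>" using elim(7) by (simp add: ennreal_mult_less_top)
    finally show ?case
      using D_pos[of "i - 1" \<omega>] by (auto simp: ennreal_mult_less_top)
  qed
  then show ?thesis unfolding Q'_def[symmetric] by (rule AE_Q')
qed

end

section \<open>Backward construction of the forward measures\<close>

text \<open>Steps are counted down from the last maturity so that primitive recursion applies:
  stage \<open>k\<close> is the forward measure \<open>P (n + 1 - k)\<close>, which drives the rate with index \<open>n - k\<close>.\<close>

primrec backward_measure ::
  "'a measure \<Rightarrow> (nat \<Rightarrow> 'a measure) \<Rightarrow> nat \<Rightarrow> nat \<Rightarrow> real \<Rightarrow> (nat \<Rightarrow> nat \<Rightarrow> real) \<Rightarrow> (nat \<Rightarrow> real) \<Rightarrow>
   (nat \<Rightarrow> 'a \<Rightarrow> real) \<Rightarrow> nat \<Rightarrow> 'a measure" where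
  "backward_measure M G n p \<delta> lam L0 X 0 = M"
| "backward_measure M G n p \<delta> lam L0 X (Suc k) =
    (let Q = backward_measure M G n p \<delta> lam L0 X k; j = n - k in
       density Q (\<lambda>\<omega>. ennreal (forward_density \<delta> (L0 j)
         (libor Q G (\<lambda>i. lam i j) X (L0 j) (p * j) \<omega>))))"

text \<open>The total exponent of \<open>X i\<close> that the rates \<open>1, \<dots>, j\<close> still alive at time \<open>i\<close> can use up.\<close>

definition remaining_exponent :: "(nat \<Rightarrow> nat \<Rightarrow> real) \<Rightarrow> nat \<Rightarrow> nat \<Rightarrow> nat \<Rightarrow> real" where
  "remaining_exponent lam p j i = (\<Sum>k | k \<in> {1..j} \<and> i \<le> p * k. lam i k)"

lemma remaining_exponent_diff:
  assumes "1 \<le> j" "i \<le> p * j"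
  shows "remaining_exponent lam p j i = remaining_exponent lam p (j - 1) i + lam i j"
proof -
  have "{k. k \<in> {1..j} \<and> i \<le> p * k} = insert j {k. k \<in> {1..j - 1} \<and> i \<le> p * k}"
    using assms by auto
  moreover have "finite {k. k \<in> {1..j - 1} \<and> i \<le> p * k}"
    by (rule finite_subset[of _ "{1..j - 1}"]) auto
  moreover have "j \<notin> {k. k \<in> {1..j - 1} \<and> i \<le> p * k}"
    using assms by auto
  ultimately show ?thesis
    by (simp add: remaining_exponent_def)
qed

locale forward_rate_family =
  fixes M :: "'a measure" and G :: "nat \<Rightarrow> 'a measure" and n p :: nat and \<delta> :: real
    and lam :: "nat \<Rightarrow> nat \<Rightarrow> real" and L0 :: "nat \<Rightarrow> real" and X :: "nat \<Rightarrow> 'a \<Rightarrow> real"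
  assumes prob_space_M: "prob_space M"
    and subalg: "\<And>i. i \<le> p * n \<Longrightarrow> subalgebra M (G i)"
    and mono: "\<And>i k. i \<le> k \<Longrightarrow> k \<le> p * n \<Longrightarrow> sets (G i) \<subseteq> sets (G k)"
    and lam_pos: "\<And>i j. i \<le> p * n \<Longrightarrow> j \<in> {1..n} \<Longrightarrow> 0 < lam i j"
    and X_meas: "\<And>i. 1 \<le> i \<Longrightarrow> i \<le> p * n \<Longrightarrow> X i \<in> borel_measurable (G i)"
    and L0_pos: "\<And>j. j \<in> {1..n} \<Longrightarrow> 0 < L0 j"
    and \<delta>_nonneg: "0 \<le> \<delta>"
    and well_defined: "drifts_well_defined M G n p lam X"
begin

abbreviation "R \<equiv> backward_measure M G n p \<delta> lam L0 X"

text \<open>The induction invariant: \<open>Q\<close> is a candidate for \<open>P (j + 1)\<close> from which the rates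
  \<open>j, \<dots>, 1\<close> can still be constructed.\<close>

definition "admissible Q j \<longleftrightarrow> prob_space Q \<and> equivalent_measures M Q \<and>
  (\<forall>i\<in>{1..p * j}. AE \<omega> in Q. nn_cond_exp Q (G (i - 1))
     (\<lambda>\<omega>. ennreal (exp (remaining_exponent lam p j i * X i \<omega>))) \<omega> < \<infinity>)"

lemma remaining_exponent_nonneg:
  assumes "j \<le> n" "i \<le> p * n"
  shows "0 \<le> remaining_exponent lam p j i"
  unfolding remaining_exponent_def
  using assms by (intro sum_nonneg) (auto intro!: less_imp_le[OF lam_pos])

lemma forward_rate_admissible:
  assumes adm: "admissible Q j" and j: "1 \<le> j" "j \<le> n"
  shows "forward_rate Q G (p * j) (\<lambda>i. lam i j) X (L0 j) \<delta>"
proof -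
  interpret Q: prob_space Q using adm by (simp add: admissible_def)
  have sets_Q: "sets Q = sets M"
    using adm by (simp add: admissible_def equivalent_measures_def)
  have space_Q: "space Q = space M" using sets_Q by (rule sets_eq_imp_space_eq)
  have le: "p * j \<le> p * n" using j by simp
  have sub: "subalgebra Q (G i)" if "i \<le> p * n" for i
    using subalg[OF that] sets_Q space_Q by (simp add: subalgebra_def)
  show ?thesis
  proof
    fix i assume i: "1 \<le> i" "i \<le> p * j"
    then have i1: "i - 1 \<le> p * n" and ip: "i \<le> p * n" using le by linarith+
    interpret S: sigma_finite_subalgebra Q "G (i - 1)"
      by (intro finite_measure_subalgebra_is_sigma_finite finite_measure_subalgebra.intro
          finite_measure_subalgebra_axioms.intro sub i1 Q.finite_measure_axioms)
    show "AE \<omega> in Q. nn_cond_exp Q (G (i - 1)) (\<lambda>\<omega>. ennreal (exp (lam i j * X i \<omega>))) \<omega> < \<infinity>"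
    proof (rule S.nn_cond_exp_exp_finite_mono)
      show "X i \<in> borel_measurable Q"
        by (rule measurable_from_subalg[OF sub[OF ip] X_meas]) (use i ip in auto)
      show "0 \<le> lam i j" using lam_pos[of i j] ip j by auto
      show "lam i j \<le> remaining_exponent lam p j i"
        using remaining_exponent_diff[of j i p lam] remaining_exponent_nonneg[of "j - 1" i] i ip j by auto
      show "AE \<omega> in Q. nn_cond_exp Q (G (i - 1))
          (\<lambda>\<omega>. ennreal (exp (remaining_exponent lam p j i * X i \<omega>))) \<omega> < \<infinity>"
        using adm i by (auto simp: admissible_def)
    qed
    show "0 < lam i j" using lam_pos[OF ip] j by simp
    show "X i \<in> borel_measurable (G i)" using X_meas i(1) ip by simp
  qed (use sub le mono L0_pos \<delta>_nonneg j in \<open>auto intro: order_trans[OF _ le]\<close>)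
qed

lemma admissible_M: "admissible M n"
  using well_defined prob_space_M
  by (simp add: admissible_def equivalent_measures_def absolutely_continuous_def
      drifts_well_defined_def remaining_exponent_def sum_distrib_right)

lemma R_Suc:
  assumes adm: "admissible (R k) (n - k)" and k: "k < n"
  shows "R (Suc k) = forward_rate.Q' (R k) G (p * (n - k)) (\<lambda>i. lam i (n - k)) X (L0 (n - k)) \<delta>"
proof -
  interpret forward_rate "R k" G "p * (n - k)" "\<lambda>i. lam i (n - k)" X "L0 (n - k)" \<delta>
    using k by (intro forward_rate_admissible[OF adm]) auto
  show ?thesis by (simp add: Q'_def Let_def)
qed

lemma admissible_R: "k \<le> n \<Longrightarrow> admissible (R k) (n - k)"
proof (induction k)
  case 0
  show ?case using admissible_M by simp
next
  case (Suc k)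
  define j where "j = n - k"
  have j: "1 \<le> j" "j \<le> n" "n - Suc k = j - 1" using Suc.prems by (auto simp: j_def)
  have adm: "admissible (R k) j" using Suc by (simp add: j_def)
  interpret forward_rate "R k" G "p * j" "\<lambda>i. lam i j" X "L0 j" \<delta>
    using j by (intro forward_rate_admissible[OF adm])
  have R: "R (Suc k) = Q'" using R_Suc[of k] adm Suc.prems by (simp add: j_def)
  have "AE \<omega> in Q'. nn_cond_exp Q' (G (i - 1))
      (\<lambda>\<omega>. ennreal (exp (remaining_exponent lam p (j - 1) i * X i \<omega>))) \<omega> < \<infinity>"
    if i: "i \<in> {1..p * (j - 1)}" for i
  proof (rule cond_exp_finite_Q')
    have le: "p * (j - 1) \<le> p * j" "p * j \<le> p * n" using j by auto
    show ij: "1 \<le> i" "i \<le> p * j" using i le(1) unfolding atLeastAtMost_iff by linarith+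
    show "0 \<le> remaining_exponent lam p (j - 1) i"
      using ij(2) j(2) le(2) by (intro remaining_exponent_nonneg) linarith+
    show "AE \<omega> in R k. nn_cond_exp (R k) (G (i - 1))
        (\<lambda>\<omega>. ennreal (exp ((remaining_exponent lam p (j - 1) i + lam i j) * X i \<omega>))) \<omega> < \<infinity>"
      using adm ij unfolding remaining_exponent_diff[OF j(1) ij(2), symmetric]
      by (auto simp: admissible_def)
  qed
  moreover have "equivalent_measures M Q'"
    using adm equivalent_Q' equivalent_measures_trans by (auto simp: admissible_def)
  ultimately show ?case
    unfolding R j(3) admissible_def using prob_space_Q' by auto
qed

lemma forward_rate_R:
  assumes "j \<in> {1..n}"
  shows "forward_rate (R (n - j)) G (p * j) (\<lambda>i. lam i j) X (L0 j) \<delta>"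
  using admissible_R[of "n - j"] assms by (intro forward_rate_admissible) auto

lemma discrete_forward_LIBOR_model_R:
  "discrete_forward_LIBOR_model n p \<delta> G L0 (\<lambda>j. R (n + 1 - j))
     (\<lambda>i j. libor (R (n - j)) G (\<lambda>i. lam i j) X (L0 j) i)"
  unfolding discrete_forward_LIBOR_model_def
proof (intro conjI ballI allI impI)
  fix j assume j: "j \<in> {2..n + 1}"
  have adm: "admissible (R (n + 1 - j)) (n - (n + 1 - j))" if "j \<in> {2..n + 1}" for j
    using that by (intro admissible_R) auto
  from adm[OF j] show "prob_space (R (n + 1 - j))" by (simp add: admissible_def)
  fix k assume k: "k \<in> {2..n + 1}"
  from adm[OF j] adm[OF k] show "equivalent_measures (R (n + 1 - j)) (R (n + 1 - k))"
    by (auto simp: admissible_def intro: equivalent_measures_trans equivalent_measures_sym)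
next
  fix j \<omega>
  show "libor (R (n - j)) G (\<lambda>i. lam i j) X (L0 j) 0 \<omega> = L0 j"
    by (simp add: libor_def)
next
  fix j assume "j \<in> {1..n}"
  then interpret forward_rate "R (n - j)" G "p * j" "\<lambda>i. lam i j" X "L0 j" \<delta>
    by (rule forward_rate_R)
  show "discrete_martingale (R (n + 1 - (j + 1))) G (p * j) (\<lambda>i. L i)"
    using L_martingale by simp
next
  fix j i assume j: "j \<in> {2..n}" and i: "i \<le> p * j"
  interpret forward_rate "R (n - j)" G "p * j" "\<lambda>i. lam i j" X "L0 j" \<delta>
    using j by (intro forward_rate_R) auto
  have n: "n + 1 - j = Suc (n - j)" "n - (n - j) = j" "n + 1 - (j + 1) = n - j" using j by auto
  then have "R (n + 1 - j) = Q'"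
    using R_Suc[OF admissible_R, of "n - j"] j by simp
  then show "AE \<omega> in restr_to_subalg (R (n + 1 - (j + 1))) (G i).
      RN_density_on (R (n + 1 - (j + 1))) (G i) (R (n + 1 - j)) \<omega>
        = ennreal ((1 + \<delta> * L i \<omega>) / (1 + \<delta> * L0 j))"
    using RN_density_Q'[OF i] unfolding n(3) by (simp add: forward_density_def)
qed

end

theorem theorem1:
  fixes n p m :: nat and Tstar \<delta> :: real and t :: "nat \<Rightarrow> real"
    and lam :: "nat \<Rightarrow> nat \<Rightarrow> real" and L0 :: "nat \<Rightarrow> real"
    and M :: "'a measure" and F :: "real \<Rightarrow> 'a measure" and X :: "nat \<Rightarrow> 'a \<Rightarrow> real"
  assumes "n \<ge> 1" and "p \<ge> 1" and "m = (n + 1) * p" and "Tstar > 0"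
    and "\<delta> = 1 / real (n + 1)"
    and "\<And>i. i \<le> m \<Longrightarrow> t i = real i / real m * Tstar"
    and "\<And>i j. i \<le> m \<Longrightarrow> j \<in> {1..n} \<Longrightarrow> lam i j > 0"
    and "\<And>j. j \<le> n \<Longrightarrow> L0 j > 0"
    and "stochastic_basis M F"
    and "\<And>i. i \<in> {1..m} \<Longrightarrow> X i \<in> borel_measurable (F (t i))"
    and "(\<integral>\<^sup>+ \<omega>. ennreal (exp (\<Sum>i=1..m. \<Sum>j=1..n. lam i j * X i \<omega>)) \<partial>M) < \<infinity>"
    and "drifts_well_defined M (\<lambda>i. F (t i)) n p lam X"
  shows "\<exists>P L. P (n + 1) = M \<and>
    discrete_forward_LIBOR_model n p \<delta> (\<lambda>i. F (t i)) L0 P L \<and>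
    (\<forall>j\<in>{1..n}. \<forall>i\<in>{1..j * p}. \<forall>\<omega>\<in>space M.
       L i j \<omega> = L0 j * exp (\<Sum>u=1..i. lam u j *
         (X u \<omega> + drift (P (j + 1)) (\<lambda>i. F (t i)) (\<lambda>i. lam i j) X u \<omega>)))"
proof -
  let ?G = "\<lambda>i. F (t i)"
  interpret B: stochastic_basis M F by fact
  have pn: "p * n \<le> m" using assms(3) by simp
  have t_nonneg: "0 \<le> t i" if "i \<le> m" for i
    using assms(4) assms(6)[OF that] by simp
  have t_mono: "t i \<le> t k" if "i \<le> k" "k \<le> m" for i k
    using assms(4) assms(6)[of i] assms(6)[of k] that
    by (simp add: divide_right_mono mult_right_mono)
  interpret forward_rate_family M ?G n p \<delta> lam L0 X
  proof
    fix i k assume ik: "i \<le> k" "k \<le> p * n"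
    show "sets (?G i) \<subseteq> sets (?G k)"
      using ik pn by (intro B.F_mono t_nonneg t_mono) auto
  next
    show "\<And>i. i \<le> p * n \<Longrightarrow> subalgebra M (?G i)"
      using pn by (intro B.subalgebra_F t_nonneg) auto
    show "\<And>i. 1 \<le> i \<Longrightarrow> i \<le> p * n \<Longrightarrow> X i \<in> borel_measurable (?G i)"
      using pn by (intro assms(10)) auto
  next
    show "\<And>i j. i \<le> p * n \<Longrightarrow> j \<in> {1..n} \<Longrightarrow> 0 < lam i j"
      using pn by (intro assms(7)) auto
  qed (use assms(5,8,12) in auto)
  show ?thesis
  proof (rule exI[where x = "\<lambda>j. R (n + 1 - j)"],
      rule exI[where x = "\<lambda>i j. libor (R (n - j)) ?G (\<lambda>i. lam i j) X (L0 j) i"],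
      intro conjI ballI)
    show "R (n + 1 - (n + 1)) = M" by simp
    show "discrete_forward_LIBOR_model n p \<delta> ?G L0 (\<lambda>j. R (n + 1 - j))
        (\<lambda>i j. libor (R (n - j)) ?G (\<lambda>i. lam i j) X (L0 j) i)"
      by (rule discrete_forward_LIBOR_model_R)
  qed (simp add: libor_def)
qed

end
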